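(* Let $\delta t>0$ be the time step size of the BDF2–Chang–Cooper scheme $$(3I-2\,\delta t\,A)f^{m+1}=4f^m-f^{m-1}+\delta t\,Q(f^m;\bar\alpha),\qquad m\ge1.$$ Let $f^0\in\mathbb{R}^N$, $f^0\ge0$, be the discrete initial condition and let $f^1$ be the second starting value at time $\delta t$, calculated from $f^0$ with the Euler scheme $(I-\tau A)g^{n}=g^{n-1}+\tau\,Q(g^{n-1};\bar\alpha)$ (one or more steps, with an appropriate time step $\tau>0$). If there exists a real number $\xi$ with $1<\xi<3$ such that $f^1\ge f^0/\xi$ and $$\delta t\le\frac{h(\xi-1)(3-\xi)}{a\xi h+2\beta(1+\omega)},$$ then the BDF2 scheme is stable in the $1$-norm, that is, $\Vert f^m\Vert_1\le\Vert f^{m-1}\Vert_1$ for all $m\ge1$, where $\Vert f\Vert_1=\sum_{i=1}^N|f_i|$.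
   Context: Setting. $\Omega=[\Omega_a,\Omega_b]$ is an interval with its end points identified (a torus). $b\in\mathbb{R}$, $\sigma^2>0$, $B=-b$, $C=\sigma^2/2>0$. The space grid is $x_i=\Omega_a+ih$, $i=0,\dots,N$, $h=(\Omega_b-\Omega_a)/N$, $N\ge 3$; since $x_0$ and $x_N$ are identified, grid functions are vectors $f=(f_1,\dots,f_N)^\top\in\mathbb{R}^N$ with indices read modulo $N$. Vector inequalities are componentwise. Matrix $A$ (Chang–Cooper discretization of $f\mapsto\partial_x(Bf+C\partial_x f)$): let $\omega=\exp(hB/C)$ and $\beta=B/(\omega-1)$ (with $\beta=C/h$ if $B=0$), so $\beta>0$. $A\in\mathbb{R}^{N\times N}$ has entries $A_{i,i}=-\beta(1+\omega)/h$, $A_{i,i-1}=\beta/h$, $A_{i,i+1}=\omega\beta/h$, $A_{1,N}=\beta/h$, $A_{N,1}=\omega\beta/h$, and all other entries $0$. Jump term: $\bar\alpha=(\alpha_1,\dots,\alpha_{N_\Theta})$ with $\alpha_j\ge0$. $\Delta=(\Omega_b-\Omega_a)/N_\Theta$, $\theta_j=\Omega_a+\Delta(j-1)$, and $\Theta_j$ is the hat function on the torus $\Theta_j(s)=1+(s-\theta_j)/\Delta$ on $[\theta_j-\Delta,\theta_j]$, $\Theta_j(s)=1-(s-\theta_j)/\Delta$ on $[\theta_j,\theta_j+\Delta]$, zero elsewhere (extended periodically, $\Theta_1\equiv\Theta_{N_\Theta+1}$). With $s_k=x_k$, put $\theta_{jk}=\Theta_j(s_k)\ge0$. For a grid function $f$,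 $\hat f_{ik}$ is $f$ translated by $s_k$ and continued by periodicity, i.e. $\hat f_{ik}=f_{i+\sigma_k}$ (index mod $N$), where the integer $\sigma_k$ is the number of grid cells of the translation by $s_k$ ($\sigma_k=s_k/h$ when $0$ is a grid point; the result does not depend on which integers $\sigma_k$ are used). Then $Q(f;\bar\alpha)\in\mathbb{R}^N$ is given by $$Q(f;\bar\alpha)_i=h\sum_{j=1}^{N_\Theta}\alpha_j\sum_{k=1}^N\hat f_{ik}\,\theta_{jk}-a f_i,\qquad a=h\sum_{j=1}^{N_\Theta}\alpha_j\sum_{k=1}^N\theta_{jk}.$$ *)

theory Defs
  imports Complex_Main "Jordan_Normal_Form.Matrix"
begin

text \<open>
  Grid functions are vectors of dimension \<open>N\<close>. Indices are read modulo \<open>N\<close> and represented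
  by \<open>0, \<dots>, N - 1\<close>, so the value at the identified grid points \<open>x\<^sub>0\<close> and \<open>x\<^sub>N\<close> is stored in
  position \<open>0\<close>.
\<close>

definition grid_step :: "real \<Rightarrow> real \<Rightarrow> nat \<Rightarrow> real" where
  "grid_step \<Omega>a \<Omega>b N = (\<Omega>b - \<Omega>a) / real N"

definition grid_point :: "real \<Rightarrow> real \<Rightarrow> nat \<Rightarrow> nat \<Rightarrow> real" where
  "grid_point \<Omega>a \<Omega>b N i = \<Omega>a + real i * grid_step \<Omega>a \<Omega>b N"

definition cc_omega :: "real \<Rightarrow> real \<Rightarrow> real \<Rightarrow> real" where
  "cc_omega h B C = exp (h * B / C)"

definition cc_beta :: "real \<Rightarrow> real \<Rightarrow> real \<Rightarrow> real" where
  "cc_beta h B C = (if B = 0 then C / h else B / (cc_omega h B C - 1))"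

text \<open>
  The corner entries \<open>A\<^sub>1\<^sub>,\<^sub>N\<close> and \<open>A\<^sub>N\<^sub>,\<^sub>1\<close> of the Chang--Cooper matrix are those with column index
  \<open>i - 1\<close> and \<open>i + 1\<close> modulo \<open>N\<close>. For \<open>N \<ge> 3\<close> the three cases below are disjoint.
\<close>

definition cc_matrix :: "nat \<Rightarrow> real \<Rightarrow> real \<Rightarrow> real \<Rightarrow> real mat" where
  "cc_matrix N h B C =
    (let \<omega> = cc_omega h B C; \<beta> = cc_beta h B C in
     mat N N (\<lambda>(i, j).
       if j = i then - \<beta> * (1 + \<omega>) / h
       else if j = (i + N - 1) mod N then \<beta> / h
       else if j = (i + 1) mod N then \<omega> * \<beta> / h
       else 0))"

definition hat :: "real \<Rightarrow> real \<Rightarrow> real \<Rightarrow> real" where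
  "hat \<Delta> \<theta> s =
    (if \<theta> - \<Delta> \<le> s \<and> s \<le> \<theta> then 1 + (s - \<theta>) / \<Delta>
     else if \<theta> \<le> s \<and> s \<le> \<theta> + \<Delta> then 1 - (s - \<theta>) / \<Delta>
     else 0)"

text \<open>
  The periodic extension of a hat: the (finite) sum over all representatives \<open>s + p L\<close> of the
  torus point \<open>s\<close> that lie in the support of the hat. If \<open>2 \<Delta> \<le> L\<close>, at most one summand is
  nonzero.
\<close>

definition periodic_hat :: "real \<Rightarrow> real \<Rightarrow> real \<Rightarrow> real \<Rightarrow> real" where
  "periodic_hat L \<Delta> \<theta> s =
    (\<Sum>p | \<theta> - \<Delta> \<le> s + of_int p * L \<and> s + of_int p * L \<le> \<theta> + \<Delta>.
       hat \<Delta> \<theta> (s + of_int p * L))"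

definition hat_basis :: "real \<Rightarrow> real \<Rightarrow> nat \<Rightarrow> nat \<Rightarrow> real \<Rightarrow> real" where
  "hat_basis \<Omega>a \<Omega>b N\<Theta> j s =
    (let \<Delta> = (\<Omega>b - \<Omega>a) / real N\<Theta>
     in periodic_hat (\<Omega>b - \<Omega>a) \<Delta> (\<Omega>a + \<Delta> * (real j - 1)) s)"

definition hat_coeff :: "real \<Rightarrow> real \<Rightarrow> nat \<Rightarrow> nat \<Rightarrow> nat \<Rightarrow> nat \<Rightarrow> real" where
  "hat_coeff \<Omega>a \<Omega>b N N\<Theta> j k = hat_basis \<Omega>a \<Omega>b N\<Theta> j (grid_point \<Omega>a \<Omega>b N k)"

definition jump_rate :: "real \<Rightarrow> real \<Rightarrow> nat \<Rightarrow> nat \<Rightarrow> (nat \<Rightarrow> real) \<Rightarrow> real" where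
  "jump_rate \<Omega>a \<Omega>b N N\<Theta> \<alpha> =
    grid_step \<Omega>a \<Omega>b N * (\<Sum>j = 1..N\<Theta>. \<alpha> j * (\<Sum>k = 1..N. hat_coeff \<Omega>a \<Omega>b N N\<Theta> j k))"

definition periodic_nth :: "real vec \<Rightarrow> int \<Rightarrow> real" where
  "periodic_nth f i = f $ nat (i mod int (dim_vec f))"

text \<open>
  \<open>shift k\<close> is the number of grid cells of the translation by \<open>s\<^sub>k = x\<^sub>k\<close>. It is a parameter
  because \<open>s\<^sub>k / h\<close> is an integer only if \<open>0\<close> is a point of the extended grid \<open>\<Omega>a + h \<int>\<close>.
\<close>

definition jump_term ::
  "real \<Rightarrow> real \<Rightarrow> nat \<Rightarrow> nat \<Rightarrow> (nat \<Rightarrow> int) \<Rightarrow> (nat \<Rightarrow> real) \<Rightarrow> real vec \<Rightarrow> real vec" where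
  "jump_term \<Omega>a \<Omega>b N N\<Theta> shift \<alpha> f =
    vec N (\<lambda>i.
      grid_step \<Omega>a \<Omega>b N *
        (\<Sum>j = 1..N\<Theta>. \<alpha> j *
          (\<Sum>k = 1..N. periodic_nth f (int i + shift k) * hat_coeff \<Omega>a \<Omega>b N N\<Theta> j k))
      - jump_rate \<Omega>a \<Omega>b N N\<Theta> \<alpha> * f $ i)"

definition one_norm :: "real vec \<Rightarrow> real" where
  "one_norm f = (\<Sum>i<dim_vec f. \<bar>f $ i\<bar>)"

end

theory Submission
  imports Defs
begin

text \<open>
  The scheme conserves the total mass of a grid function, and under the step size restriction all
  of its iterates are nonnegative. The \<open>1\<close>-norm of a nonnegative vector is its mass, so the norm is
  in fact constant in time.

  \<^emph>\<open>Mass.\<close> Both the matrix \<open>A\<close> and the jump term are combinations of differences between a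
  cyclic translate of \<open>f\<close> and \<open>f\<close> itself, and a cyclic translation does not change the mass
  (\<open>total_mass_cc_matrix\<close>, \<open>total_mass_jump_term\<close>). Hence an Euler step conserves the mass, and the
  masses of the BDF2 iterates satisfy \<open>3 S\<^sub>m\<^sub>+\<^sub>1 = 4 S\<^sub>m - S\<^sub>m\<^sub>-\<^sub>1\<close>. From \<open>S\<^sub>1 = S\<^sub>0\<close> it follows that
  \<open>S\<close> is constant.

  \<^emph>\<open>Positivity.\<close> The term \<open>-f\<^sup>m\<^sup>-\<^sup>1\<close> on the right of the BDF2 scheme prevents a direct induction on
  nonnegativity. The invariant that works is \<open>f\<^sup>m \<ge> f\<^sup>m\<^sup>-\<^sup>1 / \<xi>\<close>, together with \<open>f\<^sup>m\<^sup>-\<^sup>1 \<ge> 0\<close>: it bounds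
  \<open>-f\<^sup>m\<^sup>-\<^sup>1\<close> below by \<open>-\<xi> f\<^sup>m\<close>. To pass it on, apply \<open>3 I - 2 \<delta>t A\<close> to \<open>f\<^sup>m\<^sup>+\<^sup>1 - f\<^sup>m / \<xi>\<close> and drop the
  nonnegative off-diagonal contributions. What remains is \<open>f\<^sup>m\<close> times
  \<open>4 - \<xi> - 3 / \<xi> - \<delta>t (a + 2 \<beta> (1 + \<omega>) / (h \<xi>))\<close>, and the bound on \<open>\<delta>t\<close> says exactly that this
  factor is nonnegative, because \<open>4 - \<xi> - 3 / \<xi> = (\<xi> - 1) (3 - \<xi>) / \<xi>\<close>. A discrete minimum
  principle for \<open>3 I - 2 \<delta>t A\<close> (\<open>implicit_cc_inverse_positive\<close>) concludes.
\<close>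


section \<open>Mass and cyclic translation\<close>

definition total_mass :: "real vec \<Rightarrow> real" where
  "total_mass v = (\<Sum>i<dim_vec v. v $ i)"

lemma one_norm_eq_total_mass:
  assumes "\<And>i. i < dim_vec v \<Longrightarrow> 0 \<le> v $ i"
  shows "one_norm v = total_mass v"
  using assms by (simp add: one_norm_def total_mass_def)

lemma periodic_nth_mem:
  assumes "v \<in> carrier_vec N" "0 < N"
  obtains j where "j < N" "periodic_nth v i = v $ j"
proof -
  have "0 \<le> i mod int N" "i mod int N < int N"
    using assms by simp_all
  hence "nat (i mod int N) < N"
    by (simp add: nat_less_iff)
  thus ?thesis
    using that assms by (auto simp: periodic_nth_def)
qed

lemma sum_periodic_nth:
  assumes v: "v \<in> carrier_vec N" and N: "0 < N"
  shows "(\<Sum>i<N. periodic_nth v (int i + s)) = total_mass v"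
proof -
  have inj: "inj_on (\<lambda>i. nat ((int i + s) mod int N)) {..<N}"
  proof (rule inj_onI)
    fix i j
    assume ij: "i \<in> {..<N}" "j \<in> {..<N}"
      and "nat ((int i + s) mod int N) = nat ((int j + s) mod int N)"
    hence "(int i + s) mod int N = (int j + s) mod int N"
      using N by (simp add: eq_nat_nat_iff)
    hence "(int i + s - s) mod int N = (int j + s - s) mod int N"
      by (rule mod_diff_cong) simp
    thus "i = j" using ij by simp
  qed
  have "(\<lambda>i. nat ((int i + s) mod int N)) ` {..<N} \<subseteq> {..<N}"
    using N by (auto simp: nat_less_iff)
  hence "bij_betw (\<lambda>i. nat ((int i + s) mod int N)) {..<N} {..<N}"
    using inj by (metis bij_betw_def endo_inj_surj finite_lessThan)
  from sum.reindex_bij_betw[OF this, of "\<lambda>j. v $ j"] v show ?thesis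
    by (simp add: periodic_nth_def total_mass_def)
qed


section \<open>The Chang--Cooper matrix\<close>

lemma cc_omega_pos: "0 < cc_omega h B C"
  by (simp add: cc_omega_def)

lemma cc_beta_pos:
  assumes "0 < h" "0 < C"
  shows "0 < cc_beta h B C"
proof -
  consider "B = 0" | "0 < B" | "B < 0" by linarith
  thus ?thesis
  proof cases
    case 2
    hence "1 < cc_omega h B C" using assms by (simp add: cc_omega_def)
    thus ?thesis using 2 by (simp add: cc_beta_def)
  next
    case 3
    hence "h * B / C < 0"
      using assms by (simp add: divide_neg_pos mult_pos_neg)
    hence "cc_omega h B C < 1" by (simp add: cc_omega_def)
    thus ?thesis using 3 by (simp add: cc_beta_def divide_neg_neg)
  qed (use assms in \<open>simp add: cc_beta_def\<close>)
qed

lemma cc_matrix_carrier: "cc_matrix N h B C \<in> carrier_mat N N"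
  by (simp add: cc_matrix_def Let_def)

text \<open>
  Since the rows of the matrix sum to zero, it acts through the differences to the two neighbours.
  This form exhibits mass conservation and the minimum principle alike.
\<close>

lemma cc_matrix_mult_nth:
  assumes v: "v \<in> carrier_vec N" and N: "3 \<le> N" and i: "i < N"
  shows "(cc_matrix N h B C *\<^sub>v v) $ i =
    cc_beta h B C / h * (periodic_nth v (int i - 1) - v $ i) +
    cc_omega h B C * cc_beta h B C / h * (periodic_nth v (int i + 1) - v $ i)"
proof -
  define p where "p = (i + N - 1) mod N"
  define q where "q = (i + 1) mod N"
  define \<beta> where "\<beta> = cc_beta h B C"
  define \<omega> where "\<omega> = cc_omega h B C"
  have p: "p = (if i = 0 then N - 1 else i - 1)"
    using i N by (auto simp: p_def mod_if)
  have q: "q = (if i = N - 1 then 0 else i + 1)"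
    using i N by (auto simp: q_def)
  have pq: "p < N" "q < N" "p \<noteq> i" "q \<noteq> i" "p \<noteq> q"
    using i N by (auto simp: p q split: if_splits)
  have nth_p: "periodic_nth v (int i - 1) = v $ p"
  proof -
    have "int p = (int i - 1 + int N) mod int N"
      using N by (simp add: p_def zmod_int of_nat_diff algebra_simps)
    hence "int p = (int i - 1) mod int N" by simp
    hence "nat ((int i - 1) mod int N) = p" by (metis nat_int)
    thus ?thesis using v by (simp add: periodic_nth_def)
  qed
  have nth_q: "periodic_nth v (int i + 1) = v $ q"
  proof -
    have "int q = (int i + 1) mod int N"
      by (simp add: q_def zmod_int algebra_simps)
    hence "nat ((int i + 1) mod int N) = q" by (metis nat_int)
    thus ?thesis using v by (simp add: periodic_nth_def)
  qed
  have "(cc_matrix N h B C *\<^sub>v v) $ i = (\<Sum>j<N.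
      (if j = i then - \<beta> * (1 + \<omega>) / h else if j = p then \<beta> / h
       else if j = q then \<omega> * \<beta> / h else 0) * v $ j)"
    unfolding p_def q_def \<beta>_def \<omega>_def using i v
    by (simp add: cc_matrix_def Let_def scalar_prod_def lessThan_atLeast0)
  also have "\<dots> = (\<Sum>j<N. (if j = i then - \<beta> * (1 + \<omega>) / h * v $ j else 0)
      + (if j = p then \<beta> / h * v $ j else 0) + (if j = q then \<omega> * \<beta> / h * v $ j else 0))"
    using pq by (intro sum.cong) auto
  also have "\<dots> = - \<beta> * (1 + \<omega>) / h * v $ i + \<beta> / h * v $ p + \<omega> * \<beta> / h * v $ q"
    using i pq by (simp add: sum.distrib)
  also have "\<dots> = \<beta> / h * (v $ p - v $ i) + \<omega> * \<beta> / h * (v $ q - v $ i)"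
    by (simp add: algebra_simps add_divide_distrib diff_divide_distrib)
  finally show ?thesis
    by (simp only: nth_p nth_q \<beta>_def \<omega>_def)
qed

lemma total_mass_cc_matrix:
  assumes v: "v \<in> carrier_vec N" and N: "3 \<le> N"
  shows "total_mass (cc_matrix N h B C *\<^sub>v v) = 0"
proof -
  have "(\<Sum>i<N. periodic_nth v (int i - 1)) = total_mass v"
       "(\<Sum>i<N. periodic_nth v (int i + 1)) = total_mass v"
    using sum_periodic_nth[OF v, of "-1"] sum_periodic_nth[OF v, of 1] N by simp_all
  moreover have "(\<Sum>i<N. v $ i) = total_mass v"
    using v by (simp add: total_mass_def)
  moreover have "total_mass (cc_matrix N h B C *\<^sub>v v) = (\<Sum>i<N. (cc_matrix N h B C *\<^sub>v v) $ i)"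
    using cc_matrix_carrier[of N h B C] by (simp add: total_mass_def)
  moreover have "\<dots> = cc_beta h B C / h *
        ((\<Sum>i<N. periodic_nth v (int i - 1)) - (\<Sum>i<N. v $ i))
      + cc_omega h B C * cc_beta h B C / h *
        ((\<Sum>i<N. periodic_nth v (int i + 1)) - (\<Sum>i<N. v $ i))"
    unfolding sum_subtractf[symmetric] sum_distrib_left sum.distrib[symmetric]
    by (intro sum.cong refl cc_matrix_mult_nth[OF v N]) simp
  ultimately show ?thesis by simp
qed

text \<open>
  The off-diagonal entries of the matrix are positive, so on nonnegative vectors they only help and
  the diagonal entry is the worst that can happen. This controls the term \<open>A f\<^sup>m / \<xi>\<close> that the
  comparison with \<open>f\<^sup>m / \<xi>\<close> leaves on the right-hand side.
\<close>

lemma cc_matrix_diagonal_bound: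
  assumes v: "v \<in> carrier_vec N" and N: "3 \<le> N" and i: "i < N" and h: "0 < h" and C: "0 < C"
    and nonneg: "\<And>j. j < N \<Longrightarrow> 0 \<le> v $ j"
  shows "- (cc_beta h B C * (1 + cc_omega h B C) / h) * v $ i \<le> (cc_matrix N h B C *\<^sub>v v) $ i"
proof -
  have nbr: "0 \<le> periodic_nth v k" for k
    using periodic_nth_mem[OF v, of k] nonneg N by (metis gr0I not_numeral_le_zero)
  have "0 \<le> cc_beta h B C / h * periodic_nth v (int i - 1)"
       "0 \<le> cc_omega h B C * cc_beta h B C / h * periodic_nth v (int i + 1)"
    using nbr h cc_beta_pos[OF h C, of B] cc_omega_pos[of h B C] by simp_all
  thus ?thesis
    unfolding cc_matrix_mult_nth[OF v N i]
    by (simp add: algebra_simps add_divide_distrib diff_divide_distrib)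
qed

lemma scaled_identity_minus_mult_vec:
  fixes A :: "real mat"
  assumes "A \<in> carrier_mat N N" "v \<in> carrier_vec N"
  shows "(c \<cdot>\<^sub>m 1\<^sub>m N - d \<cdot>\<^sub>m A) *\<^sub>v v = c \<cdot>\<^sub>v v - d \<cdot>\<^sub>v (A *\<^sub>v v)"
proof -
  have "(k \<cdot>\<^sub>m X) *\<^sub>v v = k \<cdot>\<^sub>v (X *\<^sub>v v)" if "X \<in> carrier_mat N N" for k and X :: "real mat"
    using that assms(2) by (intro eq_vecI) auto
  thus ?thesis
    using assms by (simp add: minus_mult_distrib_mat_vec[where nr = N and nc = N])
qed

text \<open>
  A discrete minimum principle: at an index where \<open>v\<close> is minimal both neighbour differences are
  nonnegative, hence so is \<open>A v\<close>, and \<open>c v \<ge> d A v \<ge> 0\<close> at that index.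
\<close>

lemma implicit_cc_inverse_positive:
  assumes v: "v \<in> carrier_vec N" and N: "3 \<le> N" and h: "0 < h" and C: "0 < C"
    and c: "0 < c" and d: "0 \<le> d"
    and image_nonneg: "\<And>i. i < N \<Longrightarrow> d * (cc_matrix N h B C *\<^sub>v v) $ i \<le> c * v $ i"
    and i: "i < N"
  shows "0 \<le> v $ i"
proof -
  have "finite ((\<lambda>j. v $ j) ` {..<N})" "(\<lambda>j. v $ j) ` {..<N} \<noteq> {}"
    using N by (auto simp: lessThan_empty_iff)
  then obtain k where k: "k < N" and min: "\<And>j. j < N \<Longrightarrow> v $ k \<le> v $ j"
    using Min_in[of "(\<lambda>j. v $ j) ` {..<N}"] Min_le[of "(\<lambda>j. v $ j) ` {..<N}"]
    by (smt (verit) imageE imageI lessThan_iff)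
  have nbr: "v $ k \<le> periodic_nth v l" for l
    using periodic_nth_mem[OF v, of l] min N by (metis gr0I not_numeral_le_zero)
  have "0 \<le> (cc_matrix N h B C *\<^sub>v v) $ k"
    unfolding cc_matrix_mult_nth[OF v N k]
    using nbr h cc_beta_pos[OF h C, of B] cc_omega_pos[of h B C]
    by (intro add_nonneg_nonneg mult_nonneg_nonneg) (simp_all add: less_imp_le)
  hence "0 \<le> c * v $ k"
    using image_nonneg[OF k] d by (meson mult_nonneg_nonneg order_trans)
  hence "0 \<le> v $ k"
    using c by (simp add: zero_le_mult_iff)
  thus ?thesis using min[OF i] by simp
qed

lemma total_mass_implicit_cc:
  assumes v: "v \<in> carrier_vec N" and N: "3 \<le> N"
  shows "total_mass ((c \<cdot>\<^sub>m 1\<^sub>m N - d \<cdot>\<^sub>m cc_matrix N h B C) *\<^sub>v v) = c * total_mass v"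
proof -
  note A = cc_matrix_carrier[of N h B C]
  have dim: "dim_vec (cc_matrix N h B C *\<^sub>v v) = N" "dim_vec v = N"
    using A v by auto
  have "total_mass ((c \<cdot>\<^sub>m 1\<^sub>m N - d \<cdot>\<^sub>m cc_matrix N h B C) *\<^sub>v v)
      = c * total_mass v - d * total_mass (cc_matrix N h B C *\<^sub>v v)"
    unfolding scaled_identity_minus_mult_vec[OF A v]
    using dim by (simp add: total_mass_def sum_subtractf sum_distrib_left)
  thus ?thesis
    by (simp add: total_mass_cc_matrix[OF v N])
qed


section \<open>The jump term\<close>

lemma hat_nonneg: "0 < \<Delta> \<Longrightarrow> 0 \<le> hat \<Delta> \<theta> s"
  by (auto simp: hat_def field_simps)

lemma hat_coeff_nonneg:
  assumes "\<Omega>a < \<Omega>b" "1 \<le> N\<Theta>"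
  shows "0 \<le> hat_coeff \<Omega>a \<Omega>b N N\<Theta> j k"
  using assms
  by (auto simp: hat_coeff_def hat_basis_def periodic_hat_def Let_def intro!: sum_nonneg hat_nonneg)

lemma jump_rate_nonneg:
  assumes "\<Omega>a < \<Omega>b" "1 \<le> N\<Theta>" "\<forall>j\<in>{1..N\<Theta>}. 0 \<le> \<alpha> j"
  shows "0 \<le> jump_rate \<Omega>a \<Omega>b N N\<Theta> \<alpha>"
  unfolding jump_rate_def using assms hat_coeff_nonneg[OF assms(1,2)]
  by (intro mult_nonneg_nonneg sum_nonneg) (auto simp: grid_step_def)

lemma jump_term_diagonal_bound:
  assumes v: "v \<in> carrier_vec N" and i: "i < N"
    and \<Omega>: "\<Omega>a < \<Omega>b" and N\<Theta>: "1 \<le> N\<Theta>" and \<alpha>: "\<forall>j\<in>{1..N\<Theta>}. 0 \<le> \<alpha> j"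
    and nonneg: "\<And>j. j < N \<Longrightarrow> 0 \<le> v $ j"
  shows "- jump_rate \<Omega>a \<Omega>b N N\<Theta> \<alpha> * v $ i \<le> jump_term \<Omega>a \<Omega>b N N\<Theta> shift \<alpha> v $ i"
proof -
  have "0 \<le> periodic_nth v k" for k
    using periodic_nth_mem[OF v, of k] nonneg i by (metis gr0I not_less0)
  hence "0 \<le> grid_step \<Omega>a \<Omega>b N * (\<Sum>j = 1..N\<Theta>. \<alpha> j *
      (\<Sum>k = 1..N. periodic_nth v (int i + shift k) * hat_coeff \<Omega>a \<Omega>b N N\<Theta> j k))"
    using \<alpha> \<Omega> hat_coeff_nonneg[OF \<Omega> N\<Theta>]
    by (intro mult_nonneg_nonneg sum_nonneg) (auto simp: grid_step_def)
  thus ?thesis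
    using i by (simp add: jump_term_def)
qed

text \<open>
  Summed over the grid, every translate of \<open>v\<close> contributes the mass of \<open>v\<close>, so the gain term adds
  up to the jump rate times the mass, which is the loss.
\<close>

lemma total_mass_jump_term:
  assumes v: "v \<in> carrier_vec N" and N: "0 < N"
  shows "total_mass (jump_term \<Omega>a \<Omega>b N N\<Theta> shift \<alpha> v) = 0"
proof -
  let ?\<theta> = "hat_coeff \<Omega>a \<Omega>b N N\<Theta>"
  have "(\<Sum>i<N. \<Sum>j = 1..N\<Theta>. \<alpha> j * (\<Sum>k = 1..N. periodic_nth v (int i + shift k) * ?\<theta> j k))
      = (\<Sum>j = 1..N\<Theta>. \<Sum>i<N. \<alpha> j * (\<Sum>k = 1..N. periodic_nth v (int i + shift k) * ?\<theta> j k))"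
    by (rule sum.swap)
  also have "\<dots> = (\<Sum>j = 1..N\<Theta>. \<alpha> j * (\<Sum>k = 1..N. \<Sum>i<N. periodic_nth v (int i + shift k) * ?\<theta> j k))"
    by (subst sum.swap) (simp flip: sum_distrib_left)
  also have "\<dots> = (\<Sum>j = 1..N\<Theta>. \<alpha> j * (\<Sum>k = 1..N. ?\<theta> j k)) * total_mass v"
    unfolding sum_distrib_right[symmetric] sum_periodic_nth[OF v N]
    by (simp add: sum_distrib_left sum_distrib_right mult_ac)
  finally have gain: "(\<Sum>i<N. \<Sum>j = 1..N\<Theta>. \<alpha> j *
        (\<Sum>k = 1..N. periodic_nth v (int i + shift k) * ?\<theta> j k))
      = (\<Sum>j = 1..N\<Theta>. \<alpha> j * (\<Sum>k = 1..N. ?\<theta> j k)) * total_mass v" .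
  have mass: "(\<Sum>i<N. v $ i) = total_mass v"
    using v by (simp add: total_mass_def)
  have "total_mass (jump_term \<Omega>a \<Omega>b N N\<Theta> shift \<alpha> v) =
     grid_step \<Omega>a \<Omega>b N * (\<Sum>i<N. \<Sum>j = 1..N\<Theta>. \<alpha> j *
        (\<Sum>k = 1..N. periodic_nth v (int i + shift k) * ?\<theta> j k))
     - jump_rate \<Omega>a \<Omega>b N N\<Theta> \<alpha> * (\<Sum>i<N. v $ i)"
    unfolding total_mass_def by (simp add: jump_term_def sum_subtractf sum_distrib_left)
  also have "\<dots> = 0"
    unfolding gain mass by (simp add: jump_rate_def)
  finally show ?thesis .
qed


section \<open>Stability of the BDF2 scheme\<close>

theorem theorem4:
  fixes \<Omega>a \<Omega>b b \<sigma> h B C \<omega> \<beta> a \<delta>t \<tau> :: real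
    and N N\<Theta> M :: nat
    and shift :: "nat \<Rightarrow> int"
    and \<alpha> :: "nat \<Rightarrow> real"
    and A :: "real mat"
    and Q :: "real vec \<Rightarrow> real vec"
    and f g :: "nat \<Rightarrow> real vec"
  assumes "\<Omega>a < \<Omega>b" and "N \<ge> 3" and "N\<Theta> \<ge> 1" and "\<sigma>\<^sup>2 > 0"
    and "h = grid_step \<Omega>a \<Omega>b N"
    and "B = - b" and "C = \<sigma>\<^sup>2 / 2"
    and "\<omega> = cc_omega h B C" and "\<beta> = cc_beta h B C"
    and "A = cc_matrix N h B C"
    and "\<forall>j\<in>{1..N\<Theta>}. \<alpha> j \<ge> 0"
    and "a = jump_rate \<Omega>a \<Omega>b N N\<Theta> \<alpha>"
    and "Q = jump_term \<Omega>a \<Omega>b N N\<Theta> shift \<alpha>"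
    and "\<delta>t > 0"
    and "\<forall>m. f m \<in> carrier_vec N"
    and bdf2: "\<forall>m\<ge>1. (3 \<cdot>\<^sub>m 1\<^sub>m N - (2 * \<delta>t) \<cdot>\<^sub>m A) *\<^sub>v f (m + 1)
                 = 4 \<cdot>\<^sub>v f m - f (m - 1) + \<delta>t \<cdot>\<^sub>v Q (f m)"
    and "f 0 \<ge> 0\<^sub>v N"
    and "M \<ge> 1" and "\<tau> > 0" and "real M * \<tau> = \<delta>t"
    and "\<forall>n\<le>M. g n \<in> carrier_vec N"
    and euler: "\<forall>n\<in>{1..M}. (1\<^sub>m N - \<tau> \<cdot>\<^sub>m A) *\<^sub>v g n = g (n - 1) + \<tau> \<cdot>\<^sub>v Q (g (n - 1))"
    and "g 0 = f 0" and "g M = f 1"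
    and "\<exists>\<xi>::real. 1 < \<xi> \<and> \<xi> < 3 \<and> f 1 \<ge> (1 / \<xi>) \<cdot>\<^sub>v f 0 \<and>
           \<delta>t \<le> h * (\<xi> - 1) * (3 - \<xi>) / (a * \<xi> * h + 2 * \<beta> * (1 + \<omega>))"
  shows "\<forall>m\<ge>1. one_norm (f m) \<le> one_norm (f (m - 1))"
proof -
  obtain \<xi> where \<xi>: "1 < \<xi>" "\<xi> < 3" and start: "(1 / \<xi>) \<cdot>\<^sub>v f 0 \<le> f 1"
    and step: "\<delta>t \<le> h * (\<xi> - 1) * (3 - \<xi>) / (a * \<xi> * h + 2 * \<beta> * (1 + \<omega>))"
    using assms(25) by blast
  note f = \<open>\<forall>m. f m \<in> carrier_vec N\<close>[rule_format]
  note N = \<open>3 \<le> N\<close>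
  note A_eq = \<open>A = cc_matrix N h B C\<close>
  note Q_eq = \<open>Q = jump_term \<Omega>a \<Omega>b N N\<Theta> shift \<alpha>\<close>
  note \<alpha> = \<open>\<forall>j\<in>{1..N\<Theta>}. 0 \<le> \<alpha> j\<close>
  have A: "A \<in> carrier_mat N N"
    unfolding A_eq by (rule cc_matrix_carrier)
  have Q: "Q v \<in> carrier_vec N" for v
    unfolding Q_eq by (simp add: jump_term_def)
  have h: "0 < h"
    using \<open>\<Omega>a < \<Omega>b\<close> N \<open>h = _\<close> by (simp add: grid_step_def)
  have C: "0 < C"
    using \<open>0 < \<sigma>\<^sup>2\<close> unfolding \<open>C = _\<close> by (rule half_gt_zero)
  have \<omega>: "0 < \<omega>" and \<beta>: "0 < \<beta>"
    using cc_omega_pos cc_beta_pos[OF h C] \<open>\<omega> = _\<close> \<open>\<beta> = _\<close> by simp_all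
  have a: "0 \<le> a"
    using jump_rate_nonneg[OF \<open>\<Omega>a < \<Omega>b\<close> \<open>1 \<le> N\<Theta>\<close> \<alpha>] \<open>a = _\<close> by simp

  have Q_mass: "total_mass (Q v) = 0" if "v \<in> carrier_vec N" for v
    unfolding Q_eq using total_mass_jump_term[OF that] N by simp
  have A_lower: "- (\<beta> * (1 + \<omega>) / h) * v $ i \<le> (A *\<^sub>v v) $ i"
    if "v \<in> carrier_vec N" "i < N" "\<And>j. j < N \<Longrightarrow> 0 \<le> v $ j" for v i
    using cc_matrix_diagonal_bound[OF that(1) N that(2) h C that(3)]
    by (simp add: A_eq \<open>\<omega> = _\<close> \<open>\<beta> = _\<close>)
  have Q_lower: "- a * v $ i \<le> Q v $ i"
    if "v \<in> carrier_vec N" "i < N" "\<And>j. j < N \<Longrightarrow> 0 \<le> v $ j" for v i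
    using jump_term_diagonal_bound[OF that(1,2) \<open>\<Omega>a < \<Omega>b\<close> \<open>1 \<le> N\<Theta>\<close> \<alpha> that(3)]
    by (simp add: Q_eq \<open>a = _\<close>)

  have factor_nonneg: "0 \<le> 4 - \<xi> - 3 / \<xi> - \<delta>t * a - 2 * \<delta>t / \<xi> * (\<beta> * (1 + \<omega>) / h)"
  proof -
    have "0 < a * \<xi> * h + 2 * \<beta> * (1 + \<omega>)"
      using a \<xi> h \<beta> \<omega> by (intro add_nonneg_pos) simp_all
    hence "\<delta>t * (a * \<xi> * h + 2 * \<beta> * (1 + \<omega>)) \<le> h * (\<xi> - 1) * (3 - \<xi>)"
      using step by (simp add: pos_le_divide_eq)
    \<comment> \<open>Multiplied by \<open>\<xi> h\<close>, the factor is the numerator of the step size bound minus \<open>\<delta>t\<close> times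
      its denominator.\<close>
    hence "0 \<le> (h * (\<xi> - 1) * (3 - \<xi>) - \<delta>t * (a * \<xi> * h + 2 * \<beta> * (1 + \<omega>))) / (\<xi> * h)"
      using \<xi> h by simp
    also have "\<dots> = 4 - \<xi> - 3 / \<xi> - \<delta>t * a - 2 * \<delta>t / \<xi> * (\<beta> * (1 + \<omega>) / h)"
      using \<xi> h by (simp add: field_simps)
    finally show ?thesis .
  qed

  have invariant: "(\<forall>i<N. 0 \<le> f m $ i) \<and> (\<forall>i<N. f m $ i / \<xi> \<le> f (Suc m) $ i)" for m
  proof (induction m)
    case 0
    show ?case
      using \<open>0\<^sub>v N \<le> f 0\<close> start f[of 0] f[of 1]
      by (auto simp: less_eq_vec_def)
  next
    case (Suc m)
    let ?u = "f (Suc m)" and ?w = "f (Suc (Suc m))"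
    have u: "?u \<in> carrier_vec N" and w: "?w \<in> carrier_vec N"
      by (rule f)+
    have u_nonneg: "0 \<le> ?u $ i" if "i < N" for i
    proof -
      have "0 \<le> f m $ i / \<xi>" using Suc.IH that \<xi> by simp
      thus ?thesis using Suc.IH that by (meson order_trans)
    qed
    define v where "v = ?w - (1 / \<xi>) \<cdot>\<^sub>v ?u"
    have v: "v \<in> carrier_vec N"
      unfolding v_def using u w by simp
    have Av: "A *\<^sub>v v = A *\<^sub>v ?w - (1 / \<xi>) \<cdot>\<^sub>v (A *\<^sub>v ?u)"
      unfolding v_def using A u w
      by (simp add: mult_minus_distrib_mat_vec[where nr = N and nc = N]
          mult_mat_vec[where nr = N and nc = N])
    \<comment> \<open>The premise of the minimum principle for \<open>v\<close>. The scheme expresses the contribution of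
      \<open>f\<^sup>m\<^sup>+\<^sup>2\<close> through earlier iterates, each of which is then compared with a multiple of \<open>f\<^sup>m\<^sup>+\<^sup>1\<close>.\<close>
    have "2 * \<delta>t * (A *\<^sub>v v) $ i \<le> 3 * v $ i" if i: "i < N" for i
    proof -
      have dims: "dim_vec ?u = N" "dim_vec ?w = N" "dim_vec (f m) = N" "dim_vec (Q ?u) = N"
        "dim_row A = N"
        using u w f[of m] Q[of ?u] A by auto
      have "((3 \<cdot>\<^sub>m 1\<^sub>m N - (2 * \<delta>t) \<cdot>\<^sub>m A) *\<^sub>v ?w) $ i
          = (4 \<cdot>\<^sub>v ?u - f m + \<delta>t \<cdot>\<^sub>v Q ?u) $ i"
        using bdf2[rule_format, of "Suc m"] by simp
      hence scheme: "3 * ?w $ i - 2 * \<delta>t * (A *\<^sub>v ?w) $ i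
          = 4 * ?u $ i - f m $ i + \<delta>t * Q ?u $ i"
        unfolding scaled_identity_minus_mult_vec[OF A w] using i dims by simp
      have "f m $ i \<le> \<xi> * ?u $ i"
        using Suc.IH i \<xi> by (simp add: divide_le_eq mult.commute)
      moreover have "\<delta>t * (- a * ?u $ i) \<le> \<delta>t * Q ?u $ i"
        using Q_lower[OF u i u_nonneg] \<open>0 < \<delta>t\<close> by (intro mult_left_mono) auto
      moreover have "2 * \<delta>t / \<xi> * (- (\<beta> * (1 + \<omega>) / h) * ?u $ i) \<le> 2 * \<delta>t / \<xi> * (A *\<^sub>v ?u) $ i"
        using A_lower[OF u i u_nonneg] \<open>0 < \<delta>t\<close> \<xi> by (intro mult_left_mono) auto
      moreover have
        "0 \<le> (4 - \<xi> - 3 / \<xi> - \<delta>t * a - 2 * \<delta>t / \<xi> * (\<beta> * (1 + \<omega>) / h)) * ?u $ i"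
        using factor_nonneg u_nonneg[OF i] by simp
      moreover have "3 * v $ i - 2 * \<delta>t * (A *\<^sub>v v) $ i
          = (3 * ?w $ i - 2 * \<delta>t * (A *\<^sub>v ?w) $ i) - 3 / \<xi> * ?u $ i
            + 2 * \<delta>t / \<xi> * (A *\<^sub>v ?u) $ i"
        unfolding Av using i dims by (simp add: v_def algebra_simps)
      ultimately show ?thesis
        unfolding scheme by (simp add: left_diff_distrib mult.assoc)
    qed
    hence "0 \<le> v $ i" if "i < N" for i
      using implicit_cc_inverse_positive[OF v N h C, of 3 "2 * \<delta>t" B i] that \<open>0 < \<delta>t\<close>
      by (simp add: A_eq)
    hence "\<forall>i<N. ?u $ i / \<xi> \<le> ?w $ i"
      using u w by (auto simp: v_def)
    thus ?case using u_nonneg by blast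
  qed

  have euler_mass: "total_mass (g n) = total_mass (f 0)" if "n \<le> M" for n
    using that
  proof (induction n)
    case 0
    show ?case using \<open>g 0 = f 0\<close> by simp
  next
    case (Suc n)
    have g: "g n \<in> carrier_vec N" "g (Suc n) \<in> carrier_vec N"
      using Suc.prems \<open>\<forall>n\<le>M. g n \<in> carrier_vec N\<close> by auto
    have dims: "dim_vec (g n) = N" "dim_vec (Q (g n)) = N"
      using g Q[of "g n"] by auto
    have "total_mass (g (Suc n)) = total_mass ((1 \<cdot>\<^sub>m 1\<^sub>m N - \<tau> \<cdot>\<^sub>m A) *\<^sub>v g (Suc n))"
      using total_mass_implicit_cc[OF g(2) N, of 1] by (simp only: A_eq)
    also have "(1 \<cdot>\<^sub>m 1\<^sub>m N - \<tau> \<cdot>\<^sub>m A) *\<^sub>v g (Suc n) = g n + \<tau> \<cdot>\<^sub>v Q (g n)"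
    proof -
      have "1 \<cdot>\<^sub>m 1\<^sub>m N = (1\<^sub>m N :: real mat)" by auto
      thus ?thesis using euler[rule_format, of "Suc n"] Suc.prems by simp
    qed
    also have "total_mass \<dots> = total_mass (g n) + \<tau> * total_mass (Q (g n))"
      using dims by (simp add: total_mass_def sum.distrib sum_distrib_left)
    finally show ?case
      using Suc Q_mass[OF g(1)] by simp
  qed

  have mass: "total_mass (f (Suc m)) = total_mass (f m)" for m
  proof (induction m)
    case 0
    show ?case using euler_mass[of M] \<open>g M = f 1\<close> by simp
  next
    case (Suc m)
    have dims: "dim_vec (f m) = N" "dim_vec (f (Suc m)) = N" "dim_vec (Q (f (Suc m))) = N"
      using f[of m] f[of "Suc m"] Q[of "f (Suc m)"] by auto
    have "3 * total_mass (f (Suc (Suc m)))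
        = total_mass (4 \<cdot>\<^sub>v f (Suc m) - f m + \<delta>t \<cdot>\<^sub>v Q (f (Suc m)))"
      using bdf2[rule_format, of "Suc m"]
        total_mass_implicit_cc[OF f[of "Suc (Suc m)"] N, of 3 "2 * \<delta>t" h B C]
      by (simp add: A_eq)
    also have "\<dots> = 4 * total_mass (f (Suc m)) - total_mass (f m)
        + \<delta>t * total_mass (Q (f (Suc m)))"
      using dims by (simp add: total_mass_def sum.distrib sum_subtractf sum_distrib_left)
    finally show ?case
      using Suc.IH Q_mass[OF f] by simp
  qed

  have norm: "one_norm (f m) = total_mass (f m)" for m
    using invariant[of m] f[of m] by (intro one_norm_eq_total_mass) auto
  show ?thesis
  proof (intro allI impI)
    fix m :: nat
    assume "1 \<le> m"
    then obtain k where "m = Suc k" by (cases m) auto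
    thus "one_norm (f m) \<le> one_norm (f (m - 1))"
      using mass[of k] by (simp add: norm)
  qed
qed

end
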